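(* Let $(X,d)$ be a compact metric space, let $f:X\to X$ be a continuous surjection, and let $\mathbb{F}=(f_n)_{n\in\mathbb{N}}$ be a sequence of continuous surjections $f_n:X\to X$ such that $f_n\circ f=f\circ f_n$ for every $n\in\mathbb{N}$. Suppose $\sum_{n=1}^{\infty} D(f_n,f)<\infty$. Then: (1) if $(X,f)$ is equicontinuous, then $(X,\mathbb{F})$ is equicontinuous; (2) if, in addition, every $f_n$ is bijective and $(X,\mathbb{F})$ is equicontinuous, then $(X,f)$ is equicontinuous.
   Context: $D(g,h)=\sup_{x\in X}d(g(x),h(x))$ for continuous self maps $g,h$ of $X$. For $\mathbb{F}=(f_n)_{n\in\mathbb{N}}$ (with $\mathbb{N}=\{1,2,\dots\}$), put $\omega_n=f_n\circ f_{n-1}\circ\cdots\circ f_1$; $(X,\mathbb{F})$ denotes the non-autonomous system with orbits $\{\omega_n(x):n\in\mathbb{N}\}$. $(X,\mathbb{F})$ is equicontinuous if for every $\epsilon>0$ there is $\delta>0$ such that for all $x,y\in X$, $d(x,y)<\delta$ implies $d(\omega_n(x),\omega_n(y))<\epsilon$ for all $n\in\mathbb{N}$. $(X,f)$ is equicontinuous if the same holds with $\omega_n$ replaced by $f^n$. *)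

theory Defs
  imports "HOL-Analysis.Analysis"
begin

text \<open>
  A compact metric space is a compact subset X of a type of class metric_space; self maps of X are
  functions on the ambient type of which only the values on X matter. Sequences of maps are indexed
  by the positive naturals: the value at 0 of a sequence is never used.
\<close>

text \<open>For continuous self maps of a compact X the supremum is that of a bounded set, so the real-valued
  supremum is the intended one whenever X is nonempty.\<close>

definition unif_dist :: "'a::metric_space set \<Rightarrow> ('a \<Rightarrow> 'a) \<Rightarrow> ('a \<Rightarrow> 'a) \<Rightarrow> real" where
  "unif_dist X g h = (SUP x\<in>X. dist (g x) (h x))"

primrec omega :: "(nat \<Rightarrow> 'a \<Rightarrow> 'a) \<Rightarrow> nat \<Rightarrow> 'a \<Rightarrow> 'a" where
  "omega F 0 = id"
| "omega F (Suc n) = F (Suc n) \<circ> omega F n"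

definition nonauto_equicontinuous :: "'a::metric_space set \<Rightarrow> (nat \<Rightarrow> 'a \<Rightarrow> 'a) \<Rightarrow> bool" where
  "nonauto_equicontinuous X F \<longleftrightarrow>
     (\<forall>\<epsilon>>0. \<exists>\<delta>>0. \<forall>x\<in>X. \<forall>y\<in>X. dist x y < \<delta> \<longrightarrow>
        (\<forall>n\<ge>1. dist (omega F n x) (omega F n y) < \<epsilon>))"

definition auto_equicontinuous :: "'a::metric_space set \<Rightarrow> ('a \<Rightarrow> 'a) \<Rightarrow> bool" where
  "auto_equicontinuous X f \<longleftrightarrow>
     (\<forall>\<epsilon>>0. \<exists>\<delta>>0. \<forall>x\<in>X. \<forall>y\<in>X. dist x y < \<delta> \<longrightarrow>
        (\<forall>n\<ge>1. dist ((f ^^ n) x) ((f ^^ n) y) < \<epsilon>))"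

end

theory Submission
  imports Defs
begin

text \<open>
  Commutation lets every power of \<open>f\<close> be moved inside \<open>f\<^sub>k\<close>, so replacing \<open>f\<^sub>k\<close> by \<open>f\<close> anywhere in a
  composition costs at most \<open>D(f\<^sub>k, f)\<close>, however many powers of \<open>f\<close> are applied afterwards. Hence
  \<open>\<omega>\<^sub>N\<^sub>+\<^sub>m\<close> and \<open>f\<^sup>m \<circ> \<omega>\<^sub>N\<close> differ by at most a tail of the series, which is uniformly small in \<open>m\<close>.
  Equicontinuity of the powers \<open>f\<^sup>m\<close> then passes to the \<open>\<omega>\<^sub>N\<^sub>+\<^sub>m\<close> through the uniformly continuous map
  \<open>\<omega>\<^sub>N\<close>, and conversely through the uniformly continuous inverse of \<open>\<omega>\<^sub>N\<close>.
\<close>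

text \<open>Boundedness of \<open>X\<close> is what makes the real-valued supremum a genuine upper
  bound: the distances involved never exceed the diameter.\<close>

lemma dist_le_unif_dist:
  assumes "bounded X" "g ` X \<subseteq> X" "h ` X \<subseteq> X" "x \<in> X"
  shows "dist (g x) (h x) \<le> unif_dist X g h"
proof -
  have "dist (g y) (h y) \<le> diameter X" if "y \<in> X" for y
    using that assms by (intro diameter_bounded_bound) auto
  then have "bdd_above ((\<lambda>y. dist (g y) (h y)) ` X)"
    by (auto intro!: bdd_aboveI2)
  with \<open>x \<in> X\<close> show ?thesis
    unfolding unif_dist_def by (rule cSUP_upper)
qed

lemma funpow_mem:
  assumes "f ` X \<subseteq> X" "x \<in> X"
  shows "(f ^^ n) x \<in> X"
  using assms by (induction n) auto

lemma commute_funpow_on: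
  assumes "f ` X \<subseteq> X" "\<And>x. x \<in> X \<Longrightarrow> g (f x) = f (g x)" "x \<in> X"
  shows "g ((f ^^ n) x) = (f ^^ n) (g x)"
  by (induction n) (simp_all add: assms(2) funpow_mem[OF assms(1,3)])

lemma omega_mem:
  assumes "\<And>n. n \<ge> 1 \<Longrightarrow> F n ` X \<subseteq> X" "x \<in> X"
  shows "omega F n x \<in> X"
proof (induction n)
  case (Suc n)
  then show ?case using assms(1)[of "Suc n"] by auto
qed (simp add: assms)

lemma continuous_on_omega:
  assumes "\<And>n. n \<ge> 1 \<Longrightarrow> F n ` X \<subseteq> X" "\<And>n. n \<ge> 1 \<Longrightarrow> continuous_on X (F n)"
  shows "continuous_on X (omega F n)"
proof (induction n)
  case (Suc n)
  have "continuous_on (omega F n ` X) (F (Suc n))"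
    by (rule continuous_on_subset[OF assms(2)[of "Suc n"]]) (auto intro: omega_mem[OF assms(1)])
  with Suc show ?case unfolding omega.simps by (rule continuous_on_compose)
qed simp

lemma bij_betw_omega:
  assumes "\<And>n. n \<ge> 1 \<Longrightarrow> bij_betw (F n) X X"
  shows "bij_betw (omega F n) X X"
proof (induction n)
  case (Suc n)
  then show ?case unfolding omega.simps by (rule bij_betw_trans) (simp add: assms)
qed (simp add: bij_betw_def)

text \<open>Induction on \<open>m\<close> with \<open>N\<close> free, exchanging the innermost
  factor \<open>F (Suc N)\<close> first. Exchanging the outermost one would apply \<open>f\<close>
  to an error already made, and no Lipschitz bound on \<open>f\<close> controls that. Index
  \<open>k\<close> pays for \<open>F (Suc k)\<close>, so the sum covers exactly the factors of
  \<open>omega F (N + m)\<close> beyond \<open>omega F N\<close>.\<close>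

lemma dist_omega_funpow_le:
  assumes "bounded X" "f ` X \<subseteq> X" "\<And>n. n \<ge> 1 \<Longrightarrow> F n ` X \<subseteq> X"
    and "\<And>n x. n \<ge> 1 \<Longrightarrow> x \<in> X \<Longrightarrow> F n (f x) = f (F n x)"
    and "x \<in> X"
  shows "dist (omega F (N + m) x) ((f ^^ m) (omega F N x))
    \<le> (\<Sum>k=N..<N + m. unif_dist X (F (Suc k)) f)"
proof (induction m arbitrary: N)
  case (Suc m)
  define y where "y = omega F N x"
  have "y \<in> X" unfolding y_def using assms by (intro omega_mem)
  \<comment> \<open>Now \<open>F (Suc N)\<close> is outermost and can be compared with
    \<open>f\<close> at the common point \<open>(f ^^ m) y\<close>.\<close>
  have "(f ^^ m) (omega F (Suc N) x) = F (Suc N) ((f ^^ m) y)"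
    using commute_funpow_on[of f X "F (Suc N)" y m] assms(2,4) \<open>y \<in> X\<close> by (simp add: y_def)
  moreover have "dist (F (Suc N) ((f ^^ m) y)) (f ((f ^^ m) y)) \<le> unif_dist X (F (Suc N)) f"
    using assms \<open>y \<in> X\<close> by (intro dist_le_unif_dist funpow_mem) auto
  ultimately have "dist ((f ^^ m) (omega F (Suc N) x)) ((f ^^ Suc m) y) \<le> unif_dist X (F (Suc N)) f"
    by simp
  moreover have "dist (omega F (N + Suc m) x) ((f ^^ m) (omega F (Suc N) x))
      \<le> (\<Sum>k=Suc N..<N + Suc m. unif_dist X (F (Suc k)) f)"
    using Suc[of "Suc N"] by simp
  moreover have "(\<Sum>k=N..<N + Suc m. unif_dist X (F (Suc k)) f)
      = unif_dist X (F (Suc N)) f + (\<Sum>k=Suc N..<N + Suc m. unif_dist X (F (Suc k)) f)"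
    by (rule sum.atLeast_Suc_lessThan) simp
  ultimately show ?case
    unfolding y_def
    using dist_triangle[of "omega F (N + Suc m) x" "(f ^^ Suc m) (omega F N x)"
        "(f ^^ m) (omega F (Suc N) x)"] by linarith
qed simp

lemma omega_shadows_funpow:
  assumes "bounded X" "f ` X \<subseteq> X" "\<And>n. n \<ge> 1 \<Longrightarrow> F n ` X \<subseteq> X"
    and "\<And>n x. n \<ge> 1 \<Longrightarrow> x \<in> X \<Longrightarrow> F n (f x) = f (F n x)"
    and "summable (\<lambda>n. unif_dist X (F (Suc n)) f)" and "\<epsilon> > 0"
  obtains N where "\<And>m x. x \<in> X \<Longrightarrow> dist (omega F (N + m) x) ((f ^^ m) (omega F N x)) < \<epsilon>"
proof -
  \<comment> \<open>The Cauchy criterion bounds all blocks starting at \<open>N\<close>, whatever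
    their length, so \<open>N\<close> depends on neither \<open>m\<close> nor
    \<open>x\<close>.\<close>
  obtain N where N: "\<And>m n. m \<ge> N \<Longrightarrow> norm (\<Sum>k=m..<n. unif_dist X (F (Suc k)) f) < \<epsilon>"
    using assms(5,6) unfolding summable_Cauchy by blast
  have "dist (omega F (N + m) x) ((f ^^ m) (omega F N x)) < \<epsilon>" if "x \<in> X" for m x
    using dist_omega_funpow_le[where F = F and N = N and m = m, OF assms(1-4) that] N[of N "N + m"] by simp
  then show thesis by (rule that)
qed

lemma finite_uniformly_equicontinuous_on:
  fixes g :: "'i \<Rightarrow> 'a::metric_space \<Rightarrow> 'b::metric_space"
  assumes "finite I" "\<And>i. i \<in> I \<Longrightarrow> uniformly_continuous_on X (g i)" "\<epsilon> > 0"
  obtains \<delta> where "\<delta> > 0"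
    "\<And>i x y. i \<in> I \<Longrightarrow> x \<in> X \<Longrightarrow> y \<in> X \<Longrightarrow> dist x y < \<delta> \<Longrightarrow> dist (g i x) (g i y) < \<epsilon>"
proof -
  have "\<exists>\<delta>>0. \<forall>x\<in>X. \<forall>y\<in>X. dist x y < \<delta> \<longrightarrow> dist (g i x) (g i y) < \<epsilon>" if "i \<in> I" for i
    using assms(2)[OF that] \<open>\<epsilon> > 0\<close> unfolding uniformly_continuous_on_def
    by (metis dist_commute)
  then obtain d where d: "\<And>i. i \<in> I \<Longrightarrow> d i > 0"
    "\<And>i x y. i \<in> I \<Longrightarrow> x \<in> X \<Longrightarrow> y \<in> X \<Longrightarrow> dist x y < d i \<Longrightarrow> dist (g i x) (g i y) < \<epsilon>"
    by metis
  \<comment> \<open>The extra 1 keeps the minimum meaningful when \<open>I\<close> is empty.\<close>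
  define \<delta> where "\<delta> = Min (insert 1 (d ` I))"
  have "\<delta> > 0" "\<And>i. i \<in> I \<Longrightarrow> \<delta> \<le> d i"
    using \<open>finite I\<close> d(1) by (auto simp: \<delta>_def)
  then show thesis
    using d(2) that by (meson order_less_le_trans)
qed

theorem proposition2:
  fixes X :: "'a::metric_space set" and f :: "'a \<Rightarrow> 'a" and F :: "nat \<Rightarrow> 'a \<Rightarrow> 'a"
  assumes "compact X"
    and "continuous_on X f" and "f ` X = X"
    and "\<And>n. n \<ge> 1 \<Longrightarrow> continuous_on X (F n)"
    and "\<And>n. n \<ge> 1 \<Longrightarrow> F n ` X = X"
    and "\<And>n x. n \<ge> 1 \<Longrightarrow> x \<in> X \<Longrightarrow> F n (f x) = f (F n x)"
    and "summable (\<lambda>n. unif_dist X (F (Suc n)) f)"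
  shows "(auto_equicontinuous X f \<longrightarrow> nonauto_equicontinuous X F) \<and>
         ((\<forall>n\<ge>1. bij_betw (F n) X X) \<and> nonauto_equicontinuous X F \<longrightarrow> auto_equicontinuous X f)"
proof (intro conjI impI; (elim conjE)?)
  note bounded = compact_imp_bounded[OF assms(1)]
    and F_into = equalityD1[OF assms(5)] and f_into = equalityD1[OF assms(3)]
  have shadow: "\<exists>N. \<forall>m. \<forall>x\<in>X. dist (omega F (N + m) x) ((f ^^ m) (omega F N x)) < \<epsilon>"
    if "\<epsilon> > 0" for \<epsilon>
    using omega_shadows_funpow[where F = F, OF bounded f_into F_into assms(6,7) that] by metis
  have cont: "continuous_on X (omega F n)" for n
    using F_into assms(4) by (rule continuous_on_omega)
  have mem: "omega F n x \<in> X" if "x \<in> X" for n x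
    using F_into that by (rule omega_mem)
  {
    assume equi: "auto_equicontinuous X f"
    show "nonauto_equicontinuous X F"
      unfolding nonauto_equicontinuous_def
    proof (intro allI impI)
      fix \<epsilon> :: real assume "\<epsilon> > 0"
      then have "\<epsilon> / 3 > 0" by simp
      obtain N where N: "\<And>m x. x \<in> X \<Longrightarrow> dist (omega F (N + m) x) ((f ^^ m) (omega F N x)) < \<epsilon> / 3"
        using shadow[OF \<open>\<epsilon> / 3 > 0\<close>] by blast
      obtain \<eta> where \<eta>: "\<eta> > 0"
        "\<And>x y n. x \<in> X \<Longrightarrow> y \<in> X \<Longrightarrow> dist x y < \<eta> \<Longrightarrow> n \<ge> 1 \<Longrightarrow> dist ((f ^^ n) x) ((f ^^ n) y) < \<epsilon> / 3"
        using equi \<open>\<epsilon> / 3 > 0\<close> unfolding auto_equicontinuous_def by meson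
      \<comment> \<open>One \<delta> serves two purposes: the bound \<epsilon> settles the finitely
        many times up to \<open>N\<close>, and the bound \<eta> at time \<open>N\<close> lets
        equicontinuity of the powers of \<open>f\<close> take over.\<close>
      obtain \<delta> where \<delta>: "\<delta> > 0"
        "\<And>n x y. n \<in> {..N} \<Longrightarrow> x \<in> X \<Longrightarrow> y \<in> X \<Longrightarrow> dist x y < \<delta>
          \<Longrightarrow> dist (omega F n x) (omega F n y) < min \<epsilon> \<eta>"
        using finite_uniformly_equicontinuous_on[of "{..N}" X "omega F" "min \<epsilon> \<eta>"]
          compact_uniformly_continuous[OF cont assms(1)] \<open>\<epsilon> > 0\<close> \<open>\<eta> > 0\<close> by auto
      have "dist (omega F n x) (omega F n y) < \<epsilon>"
        if xy: "x \<in> X" "y \<in> X" "dist x y < \<delta>" for x y n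
      proof (cases "n \<le> N")
        case True
        then show ?thesis using \<delta>(2)[of n x y] xy by simp
      next
        case False
        then obtain m where n: "n = N + m" and "m \<ge> 1"
          using that[of "n - N"] by simp
        have "dist ((f ^^ m) (omega F N x)) ((f ^^ m) (omega F N y)) < \<epsilon> / 3"
          using \<eta>(2)[OF mem mem _ \<open>m \<ge> 1\<close>] \<delta>(2)[of N x y] xy by simp
        \<comment> \<open>Three legs of \<epsilon>/3: from \<open>omega\<close> to
          \<open>f ^^ m\<close> at \<open>x\<close>, across to \<open>y\<close>, and back to
          \<open>omega\<close>.\<close>
        then show ?thesis
          using dist_triangle_third[OF N[OF xy(1)] _ N[OF xy(2), unfolded dist_commute[of "omega F _ _"]]]
          unfolding n by blast
      qed
      with \<open>\<delta> > 0\<close> show "\<exists>\<delta>>0. \<forall>x\<in>X. \<forall>y\<in>X. dist x y < \<delta> \<longrightarrow>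
          (\<forall>n\<ge>1. dist (omega F n x) (omega F n y) < \<epsilon>)"
        by blast
    qed
  next
    assume bij: "\<forall>n\<ge>1. bij_betw (F n) X X" and equi: "nonauto_equicontinuous X F"
    show "auto_equicontinuous X f"
      unfolding auto_equicontinuous_def
    proof (intro allI impI)
      fix \<epsilon> :: real assume "\<epsilon> > 0"
      then have "\<epsilon> / 3 > 0" by simp
      obtain N where N: "\<And>m x. x \<in> X \<Longrightarrow> dist (omega F (N + m) x) ((f ^^ m) (omega F N x)) < \<epsilon> / 3"
        using shadow[OF \<open>\<epsilon> / 3 > 0\<close>] by blast
      obtain \<eta> where \<eta>: "\<eta> > 0"
        "\<And>x y n. x \<in> X \<Longrightarrow> y \<in> X \<Longrightarrow> dist x y < \<eta> \<Longrightarrow> n \<ge> 1 \<Longrightarrow> dist (omega F n x) (omega F n y) < \<epsilon> / 3"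
        using equi \<open>\<epsilon> / 3 > 0\<close> unfolding nonauto_equicontinuous_def by meson
      \<comment> \<open>Shadowing only concerns powers of \<open>f\<close> started at points
        \<open>omega F N z\<close>, so a given point is first pulled back along
        \<open>omega F N\<close>.\<close>
      define G where "G = inv_into X (omega F N)"
      have omega_bij: "bij_betw (omega F N) X X"
        using bij by (intro bij_betw_omega) auto
      have G_inv: "G x \<in> X" "omega F N (G x) = x" if "x \<in> X" for x
        using bij_betw_inv_into[OF omega_bij] bij_betw_inv_into_right[OF omega_bij] that
        by (auto simp: G_def bij_betw_apply)
      \<comment> \<open>A continuous injection on a compact space has a continuous inverse on its
        image.\<close>
      have "continuous_on (omega F N ` X) G"
        using omega_bij
        by (intro continuous_on_inv[OF cont assms(1)]) (simp add: G_def bij_betw_inv_into_left)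
      then have "uniformly_continuous_on X G"
        using compact_uniformly_continuous assms(1) bij_betw_imp_surj_on[OF omega_bij] by metis
      then obtain \<delta> where \<delta>: "\<delta> > 0"
        "\<And>x y. x \<in> X \<Longrightarrow> y \<in> X \<Longrightarrow> dist x y < \<delta> \<Longrightarrow> dist (G x) (G y) < \<eta>"
        using \<open>\<eta> > 0\<close> unfolding uniformly_continuous_on_def by metis
      have "dist ((f ^^ n) x) ((f ^^ n) y) < \<epsilon>"
        if xy: "x \<in> X" "y \<in> X" "dist x y < \<delta>" and "n \<ge> 1" for x y n
      proof -
        \<comment> \<open>This is shadowing from the start point \<open>G z\<close>, which
          \<open>omega F N\<close> carries to \<open>z\<close>.\<close>
        have approx: "dist ((f ^^ n) z) (omega F (N + n) (G z)) < \<epsilon> / 3" if "z \<in> X" for z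
          using N[OF G_inv(1)[OF that], of n] by (simp add: G_inv(2)[OF that] dist_commute)
        have "dist (omega F (N + n) (G x)) (omega F (N + n) (G y)) < \<epsilon> / 3"
          using \<eta>(2)[OF G_inv(1) G_inv(1)] \<delta>(2) xy \<open>n \<ge> 1\<close> by simp
        then show ?thesis
          using dist_triangle_third[OF approx[OF xy(1)] _ approx[OF xy(2), unfolded dist_commute[of "(f ^^ _) _"]]]
          by blast
      qed
      with \<open>\<delta> > 0\<close> show "\<exists>\<delta>>0. \<forall>x\<in>X. \<forall>y\<in>X. dist x y < \<delta> \<longrightarrow>
          (\<forall>n\<ge>1. dist ((f ^^ n) x) ((f ^^ n) y) < \<epsilon>)"
        by blast
    qed
  }
qed

end
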